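(* There exist perfect graphs of arbitrarily large clique-chromatic number; that is, for every positive integer $m$ there exists a perfect graph $G$ with $\chi_C(G) \geq m$.
   Context: All graphs are simple, finite, and non-null (at least one vertex). A clique of a graph $G$ is a (possibly empty) set of pairwise adjacent vertices of $G$. A set of vertices is monochromatic if all its vertices received the same color. A clique-coloring of $G$ is an assignment of colors to the vertices of $G$ such that no inclusion-wise maximal clique of $G$ of size at least two is monochromatic. A $k$-clique-coloring of $G$ is a clique-coloring $\varphi: V(G) \to \{1,\ldots,k\}$, and $G$ is $k$-clique-colorable if it has a $k$-clique-coloring (not all colors need be used). The clique-chromatic number $\chi_C(G)$ is the smallest integer $k$ such that $G$ is $k$-clique-colorable. The clique number $\omega(G)$ is the maximum size of a clique of $G$. A graph $G$ is perfect if every induced subgraph $H$ of $G$ satisfies $\chi(H) = \omega(H)$, where $\chi$ denotes the usual chromatic number. *)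

theory Defs
  imports Main "HOL-Library.Ramsey"
begin

text \<open>
  A graph is given by its vertex set and its set of edges, an edge being a two-element set of
  vertices. Cliques are those of \<^theory>\<open>HOL-Library.Ramsey\<close>: \<^term>\<open>clique K E\<close> says that
  the vertices in \<^term>\<open>K\<close> are pairwise adjacent.
\<close>

definition simple_graph :: "'a set \<Rightarrow> 'a set set \<Rightarrow> bool" where
  "simple_graph V E \<longleftrightarrow> finite V \<and> V \<noteq> {} \<and> E \<subseteq> [V]\<^bsup>2\<^esup>"

definition induced_edges :: "'a set set \<Rightarrow> 'a set \<Rightarrow> 'a set set" where
  "induced_edges E S = E \<inter> [S]\<^bsup>2\<^esup>"

definition cliques :: "'a set \<Rightarrow> 'a set set \<Rightarrow> 'a set set" where
  "cliques V E = {K. K \<subseteq> V \<and> clique K E}"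

definition maximal_clique :: "'a set \<Rightarrow> 'a set set \<Rightarrow> 'a set \<Rightarrow> bool" where
  "maximal_clique V E K \<longleftrightarrow> K \<in> cliques V E \<and> (\<forall>L \<in> cliques V E. K \<subseteq> L \<longrightarrow> L = K)"

definition clique_number :: "'a set \<Rightarrow> 'a set set \<Rightarrow> nat" where
  "clique_number V E = Max (card ` cliques V E)"

definition proper_coloring :: "'a set \<Rightarrow> 'a set set \<Rightarrow> ('a \<Rightarrow> 'c) \<Rightarrow> bool" where
  "proper_coloring V E \<phi> \<longleftrightarrow> (\<forall>u\<in>V. \<forall>v\<in>V. {u, v} \<in> E \<longrightarrow> \<phi> u \<noteq> \<phi> v)"

definition k_colorable :: "'a set \<Rightarrow> 'a set set \<Rightarrow> nat \<Rightarrow> bool" where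
  "k_colorable V E k \<longleftrightarrow> (\<exists>\<phi> :: 'a \<Rightarrow> nat. \<phi> ` V \<subseteq> {1..k} \<and> proper_coloring V E \<phi>)"

definition chromatic_number :: "'a set \<Rightarrow> 'a set set \<Rightarrow> nat" where
  "chromatic_number V E = (LEAST k. k_colorable V E k)"

definition perfect :: "'a set \<Rightarrow> 'a set set \<Rightarrow> bool" where
  "perfect V E \<longleftrightarrow> (\<forall>S. S \<subseteq> V \<and> S \<noteq> {} \<longrightarrow>
     chromatic_number S (induced_edges E S) = clique_number S (induced_edges E S))"

definition monochromatic_set :: "('a \<Rightarrow> 'c) \<Rightarrow> 'a set \<Rightarrow> bool" where
  "monochromatic_set \<phi> S \<longleftrightarrow> (\<forall>u\<in>S. \<forall>v\<in>S. \<phi> u = \<phi> v)"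

definition clique_coloring :: "'a set \<Rightarrow> 'a set set \<Rightarrow> ('a \<Rightarrow> 'c) \<Rightarrow> bool" where
  "clique_coloring V E \<phi> \<longleftrightarrow>
     (\<forall>K. maximal_clique V E K \<and> card K \<ge> 2 \<longrightarrow> \<not> monochromatic_set \<phi> K)"

definition k_clique_colorable :: "'a set \<Rightarrow> 'a set set \<Rightarrow> nat \<Rightarrow> bool" where
  "k_clique_colorable V E k \<longleftrightarrow>
     (\<exists>\<phi> :: 'a \<Rightarrow> nat. \<phi> ` V \<subseteq> {1..k} \<and> clique_coloring V E \<phi>)"

definition clique_chromatic_number :: "'a set \<Rightarrow> 'a set set \<Rightarrow> nat" where
  "clique_chromatic_number V E = (LEAST k. k_clique_colorable V E k)"

text \<open>The two minima above are taken over nonempty sets: colour all vertices differently.\<close>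

lemma ex_injective_coloring:
  assumes "finite V"
  obtains \<phi> :: "'a \<Rightarrow> nat" where "\<phi> ` V \<subseteq> {1..card V}" "inj_on \<phi> V"
proof -
  have "\<exists>h. bij_betw h V {1..card V}"
    by (rule finite_same_card_bij) (use assms in simp_all)
  then obtain h where h: "bij_betw h V {1..card V}" ..
  show thesis
    by (rule that[of h]) (use h in \<open>simp_all only: bij_betw_def order_refl\<close>)
qed

lemma k_colorable_card:
  assumes "simple_graph V E"
  shows "k_colorable V E (card V)"
proof -
  have "finite V" using assms by (simp add: simple_graph_def)
  then obtain \<phi> :: "'a \<Rightarrow> nat" where \<phi>: "\<phi> ` V \<subseteq> {1..card V}" "inj_on \<phi> V"
    by (rule ex_injective_coloring)
  have "proper_coloring V E \<phi>"
    unfolding proper_coloring_def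
  proof (intro ballI impI notI)
    fix u v assume uv: "u \<in> V" "v \<in> V" "{u, v} \<in> E" "\<phi> u = \<phi> v"
    have "{u, v} \<in> [V]\<^bsup>2\<^esup>"
      using assms uv(3) unfolding simple_graph_def by blast
    moreover have "u = v" using \<phi>(2) uv(4,1,2) by (rule inj_onD)
    ultimately show False by (simp add: nsets_def)
  qed
  with \<phi>(1) show ?thesis
    unfolding k_colorable_def by (intro exI[of _ \<phi>] conjI)
qed

lemma k_clique_colorable_card:
  assumes "simple_graph V E"
  shows "k_clique_colorable V E (card V)"
proof -
  have "finite V" using assms by (simp add: simple_graph_def)
  then obtain \<phi> :: "'a \<Rightarrow> nat" where \<phi>: "\<phi> ` V \<subseteq> {1..card V}" "inj_on \<phi> V"
    by (rule ex_injective_coloring)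
  have "\<not> monochromatic_set \<phi> K" if "K \<subseteq> V" "card K \<ge> 2" for K
  proof
    assume "monochromatic_set \<phi> K"
    then have "\<forall>u\<in>K. \<forall>v\<in>K. u = v"
      using inj_onD[OF \<phi>(2)] \<open>K \<subseteq> V\<close> unfolding monochromatic_set_def by blast
    moreover have "finite K"
      using \<open>K \<subseteq> V\<close> \<open>finite V\<close> by (rule finite_subset)
    ultimately have "card K \<le> Suc 0"
      by (simp only: card_le_Suc0_iff_eq simp_thms)
    with \<open>card K \<ge> 2\<close> show False by simp
  qed
  then have "clique_coloring V E \<phi>"
    unfolding clique_coloring_def maximal_clique_def cliques_def by blast
  with \<phi>(1) show ?thesis
    unfolding k_clique_colorable_def by (intro exI[of _ \<phi>] conjI)
qed

end

theory Submission
  imports Defs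
begin

text \<open>
  Build graphs \<open>G\<^sub>k\<close> with a distinguished root clique. The graph \<open>G\<^sub>k\<^sub>+\<^sub>1\<close> consists of a large
  root clique \<open>R\<close> to which, for every subset \<open>J\<close> of \<open>R\<close> of the right size, a private copy of
  \<open>G\<^sub>k\<close> is attached so that \<open>J\<close> consists of false twins of the roots of that copy. Thus \<open>G\<^sub>k\<^sub>+\<^sub>1\<close>
  arises by adding false twins and gluing along cliques, both of which preserve perfection.

  In a colouring with \<open>k + 1\<close> colours some \<open>J\<close> is monochromatic, say red. Each vertex \<open>v\<close> of the
  copy attached to \<open>J\<close> forms a maximal clique with its neighbours in \<open>J\<close>, so if no maximal clique is
  monochromatic, the copy avoids red. As maximal cliques of the copy stay maximal,
  it is clique-coloured with \<open>k\<close> colours, which is impossible by induction.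
\<close>

section \<open>Perfection of relations\<close>

text \<open>Using the vertices of a clique as colours makes the notion independent of any counting.\<close>

definition perf :: "('a \<Rightarrow> 'a \<Rightarrow> bool) \<Rightarrow> 'a set \<Rightarrow> bool" where
  "perf A V \<longleftrightarrow> (\<forall>S\<subseteq>V. \<exists>K c. K \<subseteq> S \<and> pairwise A K \<and> c ` S \<subseteq> K \<and>
     (\<forall>u\<in>S. \<forall>v\<in>S. A u v \<longrightarrow> c u \<noteq> c v))"

lemma perfE:
  assumes "perf A V" "S \<subseteq> V"
  obtains K c where "K \<subseteq> S" "pairwise A K" "c ` S \<subseteq> K"
    "\<And>u v. u \<in> S \<Longrightarrow> v \<in> S \<Longrightarrow> A u v \<Longrightarrow> c u \<noteq> c v"
  using assms unfolding perf_def by metis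

lemma perf_clique:
  assumes "pairwise A V" "irreflp A"
  shows "perf A V"
  unfolding perf_def
proof (intro allI impI)
  fix S assume "S \<subseteq> V"
  with assms have "S \<subseteq> S \<and> pairwise A S \<and> id ` S \<subseteq> S \<and> (\<forall>u\<in>S. \<forall>v\<in>S. A u v \<longrightarrow> id u \<noteq> id v)"
    by (auto simp: irreflp_def intro: pairwise_subset)
  then show "\<exists>K c. K \<subseteq> S \<and> pairwise A K \<and> c ` S \<subseteq> K \<and> (\<forall>u\<in>S. \<forall>v\<in>S. A u v \<longrightarrow> c u \<noteq> c v)"
    by blast
qed

text \<open>As \<open>f\<close> need not be injective, this covers both isomorphic copies and false twins.\<close>

lemma perf_vimage:
  assumes W: "perf A W" and f: "f ` V \<subseteq> W"
    and AB: "\<And>u v. u \<in> V \<Longrightarrow> v \<in> V \<Longrightarrow> B u v \<longleftrightarrow> A (f u) (f v)"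
  shows "perf B V"
  unfolding perf_def
proof (intro allI impI)
  fix S assume S: "S \<subseteq> V"
  then have "f ` S \<subseteq> W" using f by blast
  then obtain K c where K: "K \<subseteq> f ` S" "pairwise A K" and c: "c ` f ` S \<subseteq> K"
    and cp: "\<And>u v. u \<in> f ` S \<Longrightarrow> v \<in> f ` S \<Longrightarrow> A u v \<Longrightarrow> c u \<noteq> c v"
    using perfE[OF W] by metis
  define g where "g = inv_into S f"
  have g: "g k \<in> S" "f (g k) = k" if "k \<in> K" for k
    using that K(1) by (auto simp: g_def inv_into_into f_inv_into_f)
  have "g ` K \<subseteq> S" using g by blast
  moreover have "pairwise B (g ` K)"
  proof (rule pairwiseI)
    fix x y assume "x \<in> g ` K" "y \<in> g ` K" "x \<noteq> y"
    then obtain k l where "x = g k" "y = g l" "k \<in> K" "l \<in> K" "k \<noteq> l" by blast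
    then show "B x y" using g S AB[of x y] pairwiseD[OF K(2), of k l] by auto
  qed
  moreover have "(g \<circ> c \<circ> f) ` S \<subseteq> g ` K" using c by auto
  moreover have "(g \<circ> c \<circ> f) u \<noteq> (g \<circ> c \<circ> f) v" if "u \<in> S" "v \<in> S" "B u v" for u v
  proof -
    have "A (f u) (f v)" using that S AB by blast
    then have "c (f u) \<noteq> c (f v)" using cp that by blast
    moreover have "c (f u) \<in> K" "c (f v) \<in> K" using c that by auto
    ultimately show ?thesis using g(2)[of "c (f u)"] g(2)[of "c (f v)"] by auto
  qed
  ultimately show "\<exists>K c. K \<subseteq> S \<and> pairwise B K \<and> c ` S \<subseteq> K \<and>
      (\<forall>u\<in>S. \<forall>v\<in>S. B u v \<longrightarrow> c u \<noteq> c v)"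
    by (intro exI[of _ "g ` K"] exI[of _ "g \<circ> c \<circ> f"] conjI ballI impI)
qed

section \<open>Gluing perfect pieces along a clique\<close>

lemma extend_inj_on:
  assumes "finite Y" "card X \<le> card Y" "finite X" "D \<subseteq> X" "inj_on g D" "g ` D \<subseteq> Y"
  obtains h where "inj_on h X" "h ` X \<subseteq> Y" "\<And>x. x \<in> D \<Longrightarrow> h x = g x"
proof -
  have finD: "finite D" using assms finite_subset by blast
  have "card (X - D) \<le> card (Y - g ` D)"
    using assms finD by (simp add: card_Diff_subset card_image)
  then obtain f where f: "f ` (X - D) \<subseteq> Y - g ` D" "inj_on f (X - D)"
    using card_le_inj[of "X - D" "Y - g ` D"] assms by auto
  define h where "h = (\<lambda>x. if x \<in> D then g x else f x)"
  have "inj_on h X"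
  proof (rule inj_onI)
    fix x y assume "x \<in> X" "y \<in> X" "h x = h y"
    then show "x = y"
      using f assms(5) by (auto simp: h_def inj_on_def split: if_splits)
  qed
  moreover have "h ` X \<subseteq> Y" using f assms(6) by (auto simp: h_def)
  ultimately show thesis by (intro that[of h]) (auto simp: h_def)
qed

text \<open>Both colourings are injective on the overlap because it is a clique. So the colours of
  the side with the smaller clique can be renamed to agree with the other side there, and the larger
  clique supplies all colours.\<close>

lemma perf_glue:
  assumes sym: "symp A" and fin: "finite V1" "finite V2"
    and perf: "perf A V1" "perf A V2" and Q: "pairwise A (V1 \<inter> V2)"
    and sep: "\<And>u v. u \<in> V1 - V2 \<Longrightarrow> v \<in> V2 - V1 \<Longrightarrow> \<not> A u v"
  shows "perf A (V1 \<union> V2)"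
proof -
  \<comment> \<open>The first side carries the larger clique; the final case distinction applies
    this in either order.\<close>
  have glue: "\<exists>K c. K \<subseteq> S1 \<union> S2 \<and> pairwise A K \<and> c ` (S1 \<union> S2) \<subseteq> K \<and>
      (\<forall>u\<in>S1 \<union> S2. \<forall>v\<in>S1 \<union> S2. A u v \<longrightarrow> c u \<noteq> c v)"
    if fin: "finite S1" "finite S2" and card: "card K2 \<le> card K1"
      and K: "K1 \<subseteq> S1" "K2 \<subseteq> S2" "pairwise A K1"
      and c1: "c1 ` S1 \<subseteq> K1" "\<And>u v. u \<in> S1 \<Longrightarrow> v \<in> S1 \<Longrightarrow> A u v \<Longrightarrow> c1 u \<noteq> c1 v"
      and c2: "c2 ` S2 \<subseteq> K2" "\<And>u v. u \<in> S2 \<Longrightarrow> v \<in> S2 \<Longrightarrow> A u v \<Longrightarrow> c2 u \<noteq> c2 v"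
      and Q: "pairwise A (S1 \<inter> S2)"
      and sep: "\<And>u v. u \<in> S1 - S2 \<Longrightarrow> v \<in> S2 - S1 \<Longrightarrow> \<not> A u v"
    for S1 S2 K1 K2 c1 c2
  proof -
    let ?Q = "S1 \<inter> S2"
    have QA: "A x y" if "x \<in> ?Q" "y \<in> ?Q" "x \<noteq> y" for x y
      using pairwiseD[OF Q that] .
    have inj1: "inj_on c1 ?Q"
    proof (rule inj_onI, rule ccontr)
      fix x y assume "x \<in> ?Q" "y \<in> ?Q" "c1 x = c1 y" "x \<noteq> y"
      then show False using QA[of x y] c1(2)[of x y] by simp
    qed
    have inj2: "inj_on c2 ?Q"
    proof (rule inj_onI, rule ccontr)
      fix x y assume "x \<in> ?Q" "y \<in> ?Q" "c2 x = c2 y" "x \<noteq> y"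
      then show False using QA[of x y] c2(2)[of x y] by simp
    qed
    \<comment> \<open>\<open>g\<close> translates the \<open>c2\<close> colour of an overlap vertex
      into its \<open>c1\<close> colour; \<open>h\<close> below extends it to an injective renaming
      of all of \<open>K2\<close> into \<open>K1\<close>.\<close>
    define g where "g = c1 \<circ> inv_into ?Q c2"
    have g: "g (c2 x) = c1 x" if "x \<in> ?Q" for x
      using that inj2 by (simp add: g_def)
    have "inj_on g (c2 ` ?Q)"
    proof (rule inj_onI)
      fix a b assume ab: "a \<in> c2 ` ?Q" "b \<in> c2 ` ?Q" "g a = g b"
      then obtain x y where "a = c2 x" "b = c2 y" and xy: "x \<in> ?Q" "y \<in> ?Q" by blast
      moreover from this have "c1 x = c1 y" using ab(3) g[OF xy(1)] g[OF xy(2)] by simp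
      ultimately show "a = b" using inj_onD[OF inj1] by blast
    qed
    moreover have "g ` c2 ` ?Q \<subseteq> K1"
    proof (intro image_subsetI)
      fix a assume "a \<in> c2 ` ?Q"
      then obtain x where "a = c2 x" "x \<in> ?Q" by blast
      then show "g a \<in> K1" using g[of x] c1(1) by auto
    qed
    moreover have "finite K1" "finite K2"
      using finite_subset[OF K(1) fin(1)] finite_subset[OF K(2) fin(2)] .
    moreover have "c2 ` ?Q \<subseteq> K2" using c2(1) by blast
    ultimately obtain h where h: "inj_on h K2" "h ` K2 \<subseteq> K1" "\<And>x. x \<in> c2 ` ?Q \<Longrightarrow> h x = g x"
      using extend_inj_on[of K1 K2 "c2 ` ?Q" g] card by metis
    define c where "c = (\<lambda>x. if x \<in> S1 then c1 x else h (c2 x))"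
    have cS1: "c x = c1 x" if "x \<in> S1" for x using that by (simp add: c_def)
    have cS2: "c x = h (c2 x)" if "x \<in> S2" for x
      using that g[of x] h(3)[of "c2 x"] by (simp add: c_def)
    have "c ` (S1 \<union> S2) \<subseteq> K1"
      using c1(1) c2(1) h(2) unfolding c_def image_subset_iff by auto
    moreover have "c u \<noteq> c v" if "u \<in> S1 \<union> S2" "v \<in> S1 \<union> S2" "A u v" for u v
    proof (cases "u \<in> S1 \<and> v \<in> S1")
      case True
      then show ?thesis using cS1 c1(2)[of u v] that by simp
    next
      case False
      \<comment> \<open>By \<open>sep\<close>, an edge not inside \<open>S1\<close> lies inside
        \<open>S2\<close>, where \<open>c\<close> is \<open>c2\<close> followed by the injection
        \<open>h\<close>.\<close>
      then have uv: "u \<in> S2" "v \<in> S2"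
        using that(1,2) sep[of u v] sep[of v u] \<open>A u v\<close> sympD[OF sym \<open>A u v\<close>] by auto
      then have "c2 u \<noteq> c2 v" "c2 u \<in> K2" "c2 v \<in> K2" using c2(1) c2(2)[OF uv \<open>A u v\<close>] by auto
      then show ?thesis using inj_onD[OF h(1)] cS2 uv by auto
    qed
    moreover have "K1 \<subseteq> S1 \<union> S2" using K(1) by blast
    ultimately show ?thesis
      using K(3) by (intro exI[of _ K1] exI[of _ c] conjI ballI impI)
  qed
  show ?thesis
    unfolding perf_def
  proof (intro allI impI)
    fix S assume S: "S \<subseteq> V1 \<union> V2"
    define S1 S2 where "S1 = S \<inter> V1" and "S2 = S \<inter> V2"
    have S12: "S = S1 \<union> S2" "S = S2 \<union> S1" using S by (auto simp: S1_def S2_def)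
    have fS: "finite S1" "finite S2" using fin by (auto simp: S1_def S2_def)
    obtain K1 c1 where 1: "K1 \<subseteq> S1" "pairwise A K1" "c1 ` S1 \<subseteq> K1"
        "\<And>u v. u \<in> S1 \<Longrightarrow> v \<in> S1 \<Longrightarrow> A u v \<Longrightarrow> c1 u \<noteq> c1 v"
      using perfE[OF perf(1), of S1] by (metis S1_def inf_le2)
    obtain K2 c2 where 2: "K2 \<subseteq> S2" "pairwise A K2" "c2 ` S2 \<subseteq> K2"
        "\<And>u v. u \<in> S2 \<Longrightarrow> v \<in> S2 \<Longrightarrow> A u v \<Longrightarrow> c2 u \<noteq> c2 v"
      using perfE[OF perf(2), of S2] by (metis S2_def inf_le2)
    have Q': "pairwise A (S1 \<inter> S2)" "pairwise A (S2 \<inter> S1)"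
      by (rule pairwise_subset[OF Q], auto simp: S1_def S2_def)+
    have sep': "\<not> A u v" "\<not> A v u" if "u \<in> S1 - S2" "v \<in> S2 - S1" for u v
      using that sep[of u v] sympD[OF sym] by (auto simp: S1_def S2_def)
    show "\<exists>K c. K \<subseteq> S \<and> pairwise A K \<and> c ` S \<subseteq> K \<and> (\<forall>u\<in>S. \<forall>v\<in>S. A u v \<longrightarrow> c u \<noteq> c v)"
    proof (cases "card K2 \<le> card K1")
      case True
      then show ?thesis
        unfolding S12(1) using glue[OF fS True 1(1) 2(1) 1(2,3,4) 2(3,4) Q'(1) sep'(1)] by blast
    next
      case False
      then have "card K1 \<le> card K2" by simp
      then show ?thesis
        unfolding S12(2) using glue[OF fS(2,1) _ 2(1) 1(1) 2(2,3,4) 1(3,4) Q'(2) sep'(2)] by blast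
    qed
  qed
qed

section \<open>The construction\<close>

text \<open>
  The vertex \<open>(i, [J\<^sub>1, \<dots>, J\<^sub>r])\<close> lies in the copy attached to \<open>J\<^sub>r\<close> inside the copy attached to
  \<open>J\<^sub>r\<^sub>-\<^sub>1\<close> and so on; the roots are the vertices \<open>(i, [])\<close>.
\<close>

type_synonym vertex = "nat \<times> nat set list"

text \<open>The factor \<open>Suc k\<close> serves the pigeonhole principle: with at most
  \<open>Suc k\<close> colours on the roots, some colour occurs on \<open>root_size k\<close> of
  them. The base value 2 keeps the monochromatic cliques from being singletons.\<close>

fun root_size :: "nat \<Rightarrow> nat" where
  "root_size 0 = 2"
| "root_size (Suc k) = Suc k * root_size k"

definition shift :: "nat set \<Rightarrow> vertex \<Rightarrow> vertex" where
  "shift J v = (fst v, J # snd v)"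

text \<open>The copy attached to \<open>J\<close> uses \<open>J\<close> itself as index set, so its
  root \<open>(j, [J])\<close> and the twin \<open>(j, [])\<close> share their first
  component.\<close>

fun verts :: "nat \<Rightarrow> nat set \<Rightarrow> vertex set" where
  "verts 0 I = (\<lambda>i. (i, [])) ` I"
| "verts (Suc k) I = (\<lambda>i. (i, [])) ` I \<union>
     (\<Union>J\<in>{J. J \<subseteq> I \<and> card J = root_size k}. shift J ` verts k J)"

text \<open>The test on \<open>last\<close> encodes the twin relations of all levels at once:
  \<open>(j, \<tau>)\<close> is a root of the innermost copy, attached to
  \<open>last \<tau>\<close>, and the outer roots adjacent to it are the twins of its fellow roots
  there.\<close>

fun adj :: "vertex \<Rightarrow> vertex \<Rightarrow> bool" where
  "adj (i, []) (j, \<tau>) \<longleftrightarrow> i \<noteq> j \<and> (\<tau> \<noteq> [] \<longrightarrow> i \<in> last \<tau>)"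
| "adj (i, J # \<sigma>) (j, []) \<longleftrightarrow> i \<noteq> j \<and> j \<in> last (J # \<sigma>)"
| "adj (i, J # \<sigma>) (j, J' # \<tau>) \<longleftrightarrow> J = J' \<and> adj (i, \<sigma>) (j, \<tau>)"

lemma root_size_ge_2: "2 \<le> root_size k"
  by (induction k) auto

lemma adj_fst_neq: "adj u v \<Longrightarrow> fst u \<noteq> fst v"
  by (induction u v rule: adj.induct) auto

lemma adj_commute: "adj u v \<longleftrightarrow> adj v u"
proof (induction u v rule: adj.induct)
  case (1 i j \<tau>)
  then show ?case by (cases \<tau>) auto
qed auto

lemma adj_root: "adj (i, \<sigma>) (j, []) \<longleftrightarrow> i \<noteq> j \<and> (\<sigma> \<noteq> [] \<longrightarrow> j \<in> last \<sigma>)"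
  by (cases \<sigma>) auto

text \<open>This is the false-twin property: deleting a leading \<open>J\<close> identifies
  \<open>(j, [])\<close> with \<open>(j, [J])\<close>, while \<open>tl [] = []\<close> leaves roots
  in place.\<close>

lemma adj_tl:
  assumes "\<sigma> = [] \<Longrightarrow> i \<in> J" "\<tau> = [] \<Longrightarrow> j \<in> J"
    and "\<sigma> \<noteq> [] \<Longrightarrow> hd \<sigma> = J" "\<tau> \<noteq> [] \<Longrightarrow> hd \<tau> = J"
  shows "adj (i, \<sigma>) (j, \<tau>) \<longleftrightarrow> adj (i, tl \<sigma>) (j, tl \<tau>)"
proof (cases \<sigma>)
  case Nil
  then show ?thesis using assms by (cases \<tau>) auto
next
  case (Cons J' \<sigma>')
  then show ?thesis using assms by (cases \<tau>) (auto simp: adj_root)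
qed

lemma symp_adj: "symp adj"
  by (rule sympI) (simp add: adj_commute)

lemma adj_shift: "adj (shift J u) (shift J' v) \<longleftrightarrow> J = J' \<and> adj u v"
  by (cases u; cases v) (simp add: shift_def)

lemma root_in_verts: "(i, []) \<in> verts k I \<longleftrightarrow> i \<in> I"
  by (cases k) (auto simp: shift_def)

lemma shift_in_verts:
  "J \<subseteq> I \<Longrightarrow> card J = root_size k \<Longrightarrow> v \<in> verts k J \<Longrightarrow> shift J v \<in> verts (Suc k) I"
  by auto

lemma verts_Suc_cases:
  assumes "v \<in> verts (Suc k) I"
  obtains (root) i where "v = (i, [])" "i \<in> I"
    | (shift) J w where "v = shift J w" "J \<subseteq> I" "card J = root_size k" "w \<in> verts k J"
  using assms by auto

lemma finite_verts: "finite I \<Longrightarrow> finite (verts k I)"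
proof (induction k arbitrary: I)
  case (Suc k)
  then have "finite {J. J \<subseteq> I \<and> card J = root_size k}" by simp
  with Suc show ?case using finite_subset by auto
qed simp

text \<open>\<open>last (I # \<sigma>)\<close> is the index set of the innermost copy containing the
  vertex; prefixing \<open>I\<close> covers the outermost roots.\<close>

lemma verts_last:
  assumes "(i, \<sigma>) \<in> verts k I"
  shows "i \<in> last (I # \<sigma>)" "last (I # \<sigma>) \<subseteq> I"
    "card I = root_size k \<Longrightarrow> 2 \<le> card (last (I # \<sigma>))"
proof -
  have "i \<in> last (I # \<sigma>) \<and> last (I # \<sigma>) \<subseteq> I \<and>
    (card I = root_size k \<longrightarrow> 2 \<le> card (last (I # \<sigma>)))"
    using assms
  proof (induction k arbitrary: I \<sigma>)
    case 0
    then show ?case by auto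
  next
    case (Suc k)
    from Suc.prems show ?case
    proof (cases rule: verts_Suc_cases)
      case root
      then show ?thesis using root_size_ge_2[of "Suc k"] by auto
    next
      case (shift J w)
      then have "\<sigma> = J # snd w" "(i, snd w) \<in> verts k J" by (auto simp: shift_def)
      then show ?thesis using Suc.IH shift by fastforce
    qed
  qed
  then show "i \<in> last (I # \<sigma>)" "last (I # \<sigma>) \<subseteq> I"
    "card I = root_size k \<Longrightarrow> 2 \<le> card (last (I # \<sigma>))" by auto
qed

text \<open>Two adjacent vertices lie in a common copy, handled by induction, or one of them is a
  root. The bound confines the index of any vertex that could extend a clique through
  \<open>(i, \<sigma>)\<close>.\<close>

lemma adj_fst_in_last:
  assumes "(i, \<sigma>) \<in> verts k I" "w \<in> verts k I" "adj (i, \<sigma>) w"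
  shows "fst w \<in> last (I # \<sigma>)"
  using assms
proof (induction k arbitrary: I \<sigma> w)
  case 0
  then show ?case by auto
next
  case (Suc k)
  from Suc.prems(1) show ?case
  proof (cases rule: verts_Suc_cases)
    case root
    moreover have "(fst w, snd w) \<in> verts (Suc k) I" using Suc.prems(2) by simp
    ultimately show ?thesis using verts_last(1,2)[of "fst w" "snd w" "Suc k" I] by auto
  next
    case (shift J v)
    then have \<sigma>: "\<sigma> = J # snd v" "v = (i, snd v)" by (auto simp: shift_def)
    from Suc.prems(2) show ?thesis
    proof (cases rule: verts_Suc_cases)
      case root
      then show ?thesis using Suc.prems(3) \<sigma> by auto
    next
      case (shift J' w')
      then have "J' = J" "adj v w'"
        using Suc.prems(3) \<open>(i, \<sigma>) = shift J v\<close> adj_shift by auto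
      then have "fst w' \<in> last (J # snd v)"
        using Suc.IH[of "snd v" J w'] \<sigma>(2) shift \<open>v \<in> verts k J\<close> by auto
      then show ?thesis using shift \<sigma> by (simp add: shift_def)
    qed
  qed
qed

section \<open>Perfection of the construction\<close>

lemma perf_verts: "finite I \<Longrightarrow> perf adj (verts k I)"
proof (induction k arbitrary: I)
  case 0
  show ?case
    by (rule perf_clique) (auto simp: pairwise_def irreflp_def dest: adj_fst_neq)
next
  case (Suc k)
  let ?R = "\<lambda>I. (\<lambda>i. (i, [])) ` I :: vertex set"
  \<comment> \<open>A copy together with the roots it is attached to: dropping the leading
    \<open>J\<close> collapses twins and maps this piece into \<open>verts k J\<close>.\<close>
  have piece: "perf adj (?R J \<union> shift J ` verts k J)" if "J \<subseteq> I" for J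
  proof (rule perf_vimage)
    show "perf adj (verts k J)" using Suc.IH finite_subset[OF that Suc.prems] .
    show "(\<lambda>(i, \<sigma>). (i, tl \<sigma>)) ` (?R J \<union> shift J ` verts k J) \<subseteq> verts k J"
      by (auto simp: shift_def root_in_verts)
    fix u v assume uv: "u \<in> ?R J \<union> shift J ` verts k J" "v \<in> ?R J \<union> shift J ` verts k J"
    show "adj u v \<longleftrightarrow> adj (case u of (i, \<sigma>) \<Rightarrow> (i, tl \<sigma>)) (case v of (i, \<sigma>) \<Rightarrow> (i, tl \<sigma>))"
    proof (cases u)
      case u: (Pair i \<sigma>)
      show ?thesis
      proof (cases v)
        case v: (Pair j \<tau>)
        have "i \<in> J" if "\<sigma> = []" using uv(1) u that by (auto simp: shift_def)
        moreover have "j \<in> J" if "\<tau> = []" using uv(2) v that by (auto simp: shift_def)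
        moreover have "hd \<sigma> = J" if "\<sigma> \<noteq> []" using uv(1) u that by (auto simp: shift_def)
        moreover have "hd \<tau> = J" if "\<tau> \<noteq> []" using uv(2) v that by (auto simp: shift_def)
        ultimately show ?thesis
          unfolding u v prod.case by (rule adj_tl)
      qed
    qed
  qed
  have fin: "finite (verts k J)" if "J \<subseteq> I" for J
    using finite_verts[OF finite_subset[OF that Suc.prems]] .
  \<comment> \<open>The pieces are glued on one at a time; \<open>F\<close> collects the sets whose
    copies are already present.\<close>
  have "perf adj (?R I \<union> (\<Union>J\<in>F. shift J ` verts k J))"
    if "finite F" "F \<subseteq> {J. J \<subseteq> I \<and> card J = root_size k}" for F
    using that
  proof (induction F rule: finite_induct)
    case empty
    show ?case
      by (rule perf_clique) (auto simp: pairwise_def irreflp_def dest: adj_fst_neq)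
  next
    case (insert J F)
    let ?V1 = "?R I \<union> (\<Union>J\<in>F. shift J ` verts k J)" and ?V2 = "?R J \<union> shift J ` verts k J"
    have J: "J \<subseteq> I" using insert.prems by simp
    have disj: "shift J u \<notin> ?V1" for u
      using insert.hyps(2) by (auto simp: shift_def)
    have "?V1 \<union> ?V2 = ?R I \<union> (\<Union>J\<in>insert J F. shift J ` verts k J)" using J by auto
    moreover have "perf adj (?V1 \<union> ?V2)"
    proof (rule perf_glue[OF symp_adj])
      show "finite ?V1" "finite ?V2"
        using insert.hyps(1) insert.prems J fin Suc.prems finite_subset[OF J Suc.prems]
        by (simp_all add: subset_iff)
      show "perf adj ?V1" using insert.IH insert.prems by simp
      show "perf adj ?V2" using piece[OF J] .
      \<comment> \<open>Different copies are disjoint, so the new piece meets the old graph only in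
        the root clique indexed by \<open>J\<close>.\<close>
      have "?V1 \<inter> ?V2 \<subseteq> ?R J"
      proof
        fix x assume x: "x \<in> ?V1 \<inter> ?V2"
        then have "x \<notin> shift J ` verts k J" using disj by fast
        moreover have "x \<in> ?R J \<or> x \<in> shift J ` verts k J" using IntD2[OF x] by (rule UnE) auto
        ultimately show "x \<in> ?R J" by simp
      qed
      then show "pairwise adj (?V1 \<inter> ?V2)"
        by (rule pairwise_subset[rotated]) (auto simp: pairwise_def)
      fix u v assume u: "u \<in> ?V1 - ?V2" and v: "v \<in> ?V2 - ?V1"
      have "?R J \<subseteq> ?V1" using J by blast
      moreover have "v \<notin> ?V1" using v by simp
      ultimately have "v \<notin> ?R J" by (rule contra_subsetD)
      with DiffD1[OF v] have "v \<in> shift J ` verts k J" by simp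
      then obtain j \<sigma> where w: "v = shift J (j, \<sigma>)" "(j, \<sigma>) \<in> verts k J" by auto
      \<comment> \<open>A vertex of the copy at \<open>J\<close> is adjacent to no root outside
        \<open>J\<close>, and distinct copies are not joined.\<close>
      from DiffD1[OF u] consider i where "i \<notin> J" "u = (i, [])" | J' u' where "u = shift J' u'" "J' \<noteq> J"
      proof (rule UnE)
        assume "u \<in> ?R I"
        then obtain i where "u = (i, [])" by blast
        with DiffD2[OF u] that(1) show thesis by auto
      next
        assume "u \<in> (\<Union>J\<in>F. shift J ` verts k J)"
        then obtain J' u' where "J' \<in> F" "u = shift J' u'" by auto
        moreover from this have "J' \<noteq> J" using insert.hyps(2) by blast
        ultimately show thesis using that(2) by blast
      qed
      then show "\<not> adj u v"
      proof cases
        case 1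
        then show ?thesis using verts_last(2)[OF w(2)] w(1) by (auto simp: shift_def)
      next
        case 2
        then show ?thesis using w by (simp add: adj_shift)
      qed
    qed
    ultimately show ?case by simp
  qed
  from this[of "{J. J \<subseteq> I \<and> card J = root_size k}"] show ?case using Suc.prems by simp
qed

section \<open>Maximal cliques and monochromatic ones among them\<close>

definition max_clique_rel :: "('a \<Rightarrow> 'a \<Rightarrow> bool) \<Rightarrow> 'a set \<Rightarrow> 'a set \<Rightarrow> bool" where
  "max_clique_rel A V K \<longleftrightarrow> K \<subseteq> V \<and> pairwise A K \<and> (\<forall>w\<in>V - K. \<exists>u\<in>K. \<not> A u w)"

text \<open>A vertex \<open>w\<close> extending the clique would have its index in
  \<open>last \<sigma> - {i}\<close>. Then the clique already contains the root
  \<open>(fst w, [])\<close>, which is not adjacent to \<open>w\<close> because adjacent vertices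
  have different indices.\<close>

lemma max_clique_rel_root_neighbours:
  assumes v: "(i, \<sigma>) \<in> verts k I" "\<sigma> \<noteq> []"
  shows "max_clique_rel adj (verts k I) (insert (i, \<sigma>) ((\<lambda>j. (j, [])) ` (last \<sigma> - {i})))"
    (is "max_clique_rel _ _ ?K")
  unfolding max_clique_rel_def
proof (intro conjI ballI)
  show "?K \<subseteq> verts k I"
    using v verts_last(2)[OF v(1)] by (auto simp: root_in_verts)
  show "pairwise adj ?K"
    using v(2) by (auto simp: pairwise_def adj_root)
  fix w assume w: "w \<in> verts k I - ?K"
  show "\<exists>u\<in>?K. \<not> adj u w"
  proof (rule ccontr)
    assume "\<not> ?thesis"
    then have a: "adj u w" if "u \<in> ?K" for u using that by blast
    have "adj (i, \<sigma>) w" by (rule a) simp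
    with v w have "fst w \<in> last \<sigma> - {i}"
      using adj_fst_in_last[OF v(1), of w] adj_fst_neq[of "(i, \<sigma>)" w] by simp
    then have "adj (fst w, []) w" by (intro a) simp
    then show False using adj_fst_neq[of "(fst w, [])" w] by simp
  qed
qed

text \<open>An outer vertex extending the shifted clique is in the same copy or is a root; in either
  case some vertex of the copy would extend \<open>K\<close>.\<close>

lemma max_clique_rel_shift:
  assumes K: "max_clique_rel adj (verts k J) K" "K \<noteq> {}" and J: "J \<subseteq> I" "card J = root_size k"
  shows "max_clique_rel adj (verts (Suc k) I) (shift J ` K)"
  unfolding max_clique_rel_def
proof (intro conjI ballI)
  have KV: "K \<subseteq> verts k J" "pairwise adj K" and Kmax: "\<And>w. w \<in> verts k J \<Longrightarrow> w \<notin> K \<Longrightarrow> \<exists>u\<in>K. \<not> adj u w"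
    using K(1) unfolding max_clique_rel_def by simp_all
  show "shift J ` K \<subseteq> verts (Suc k) I" using shift_in_verts[OF J] KV by blast
  show "pairwise adj (shift J ` K)" using KV by (auto simp: pairwise_def adj_shift)
  fix w assume w: "w \<in> verts (Suc k) I - shift J ` K"
  show "\<exists>u\<in>shift J ` K. \<not> adj u w"
  proof (rule ccontr)
    assume "\<not> ?thesis"
    then have a: "adj (shift J u) w" if "u \<in> K" for u using that by blast
    obtain u where u: "u \<in> K" using K(2) by blast
    from w have "w \<in> verts (Suc k) I" by blast
    then show False
    proof (cases rule: verts_Suc_cases)
      \<comment> \<open>The root \<open>(l, [])\<close> of \<open>verts k J\<close>, twin to the
        outer root, would be adjacent to all of \<open>K\<close>; its index differs from all indices
        in \<open>K\<close>, so it is a new vertex.\<close>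
      case (root l)
      have *: "l \<noteq> fst u \<and> l \<in> last (J # snd u)" if "u \<in> K" for u
        using a[OF that] root by (cases u) (auto simp: shift_def)
      have "l \<in> J"
        using *[OF u] subsetD[OF KV(1) u] verts_last(2)[of "fst u" "snd u" k J] by auto
      moreover have "(l, []) \<notin> K" using * by fastforce
      ultimately obtain u' where u': "u' \<in> K" "\<not> adj u' (l, [])"
        using Kmax root_in_verts by blast
      then show False
        using *[OF u'(1)] by (cases u') (auto simp: adj_root)
    next
      case (shift J' w')
      then have "J' = J" using a[OF u] by (simp add: adj_shift)
      then have "adj u w'" if "u \<in> K" for u using a[OF that] shift by (simp add: adj_shift)
      moreover have "w' \<in> verts k J" "w' \<notin> K" using w shift \<open>J' = J\<close> by auto
      ultimately show False using Kmax by blast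
    qed
  qed
qed

text \<open>The colour set \<open>C\<close> is arbitrary so that the induction can delete a colour
  from it. For \<open>k = 0\<close> it is empty, whereas the graph has vertices.\<close>

lemma monochromatic_max_clique:
  fixes \<phi> :: "vertex \<Rightarrow> 'c"
  assumes "card I = root_size k" "finite C" "card C \<le> k" "\<phi> ` verts k I \<subseteq> C"
  shows "\<exists>K. max_clique_rel adj (verts k I) K \<and> 2 \<le> card K \<and> monochromatic_set \<phi> K"
  using assms
proof (induction k arbitrary: I C \<phi>)
  case 0
  then show ?case by auto
next
  case (Suc k)
  define cls where "cls c = {i \<in> I. \<phi> (i, []) = c}" for c
  have pos: "0 < root_size k" using root_size_ge_2[of k] by simp
  have finI: "finite I" using Suc.prems(1) pos by (intro card_ge_0_finite) simp
  \<comment> \<open>Pigeonhole: if all classes were smaller, they could not cover the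
    \<open>Suc k * root_size k\<close> roots.\<close>
  have "\<exists>c\<in>C. root_size k \<le> card (cls c)"
  proof (rule ccontr)
    assume "\<not> ?thesis"
    then have small: "card (cls c) < root_size k" if "c \<in> C" for c using that by force
    have root: "\<phi> (i, []) \<in> C" if "i \<in> I" for i
      using Suc.prems(4) root_in_verts[of i "Suc k" I] that by blast
    have "I \<noteq> {}" using Suc.prems(1) pos by force
    then have ne: "C \<noteq> {}" using root by blast
    have "I = (\<Union>c\<in>C. cls c)" using root by (auto simp: cls_def)
    then have "card I \<le> (\<Sum>c\<in>C. card (cls c))"
      using card_UN_le[OF Suc.prems(2), of cls] by simp
    also have "\<dots> < (\<Sum>c\<in>C. root_size k)"
      using small ne Suc.prems(2) by (intro sum_strict_mono) auto
    also have "\<dots> \<le> Suc k * root_size k" using Suc.prems(3) by (simp del: mult_Suc)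
    finally show False using Suc.prems(1) by simp
  qed
  then obtain c J where c: "c \<in> C" and J: "J \<subseteq> cls c" "card J = root_size k"
    using obtain_subset_with_card_n by metis
  have JI: "J \<subseteq> I" and Jc: "\<And>j. j \<in> J \<Longrightarrow> \<phi> (j, []) = c" using J by (auto simp: cls_def)
  show ?case
  proof (cases "\<exists>v\<in>verts k J. \<phi> (shift J v) = c")
    \<comment> \<open>A vertex of the copy has colour \<open>c\<close>. Its root neighbours with
      index in \<open>?L\<close> lie in \<open>J\<close>, so they have colour \<open>c\<close> as
      well.\<close>
    case True
    then obtain i \<sigma> where v: "(i, \<sigma>) \<in> verts k J" "\<phi> (i, J # \<sigma>) = c"
      by (auto simp: shift_def)
    let ?L = "last (J # \<sigma>)"
    let ?K = "insert (i, J # \<sigma>) ((\<lambda>j. (j, [])) ` (?L - {i}))"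
    have L: "i \<in> ?L" "?L \<subseteq> J" "2 \<le> card ?L" using verts_last[OF v(1)] J by auto
    have finL: "finite ?L" using finite_subset[OF order_trans[OF L(2) JI] finI] .
    have "(i, J # \<sigma>) \<in> verts (Suc k) I"
      using shift_in_verts[OF JI J(2) v(1)] by (simp add: shift_def)
    then have "max_clique_rel adj (verts (Suc k) I) ?K"
      by (rule max_clique_rel_root_neighbours) simp
    moreover have "2 \<le> card ?K"
    proof -
      have "(i, J # \<sigma>) \<notin> (\<lambda>j. (j, [])) ` (?L - {i})" by auto
      moreover have "card ((\<lambda>j. (j, [] :: nat set list)) ` (?L - {i})) = card (?L - {i})"
        by (rule card_image) (auto simp: inj_on_def)
      ultimately show ?thesis using finL L by (simp add: card_Diff_singleton)
    qed
    moreover have "monochromatic_set \<phi> ?K"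
    proof -
      have "\<phi> u = c" if "u \<in> ?K" for u
        using that v(2) Jc[OF subsetD[OF L(2)]] by (auto simp del: last.simps)
      then show ?thesis unfolding monochromatic_set_def by simp
    qed
    ultimately show ?thesis by blast
  next
    case False
    \<comment> \<open>The copy avoids \<open>c\<close>, so the induction hypothesis applies with one
      colour fewer.\<close>
    have "(\<phi> \<circ> shift J) ` verts k J \<subseteq> C - {c}"
    proof (intro image_subsetI)
      fix v assume v: "v \<in> verts k J"
      then have "\<phi> (shift J v) \<in> C" using Suc.prems(4) shift_in_verts[OF JI J(2) v] by blast
      then show "(\<phi> \<circ> shift J) v \<in> C - {c}" using False v by simp
    qed
    moreover have "card (C - {c}) \<le> k" using Suc.prems c by simp
    ultimately obtain K where K: "max_clique_rel adj (verts k J) K" "2 \<le> card K"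
        "monochromatic_set (\<phi> \<circ> shift J) K"
      using Suc.IH[OF J(2), of "C - {c}" "\<phi> \<circ> shift J"] Suc.prems(2) by blast
    have "inj (shift J)" by (auto simp: inj_def shift_def prod_eq_iff)
    then have "card (shift J ` K) = card K" by (intro card_image) (auto simp: inj_on_def)
    moreover have "K \<noteq> {}" using K(2) by auto
    then have "max_clique_rel adj (verts (Suc k) I) (shift J ` K)"
      using max_clique_rel_shift[OF K(1) _ JI J(2)] by simp
    moreover have "monochromatic_set \<phi> (shift J ` K)"
      using K(3) unfolding monochromatic_set_def comp_def by blast
    ultimately show ?thesis using K(2) by (intro exI[of _ "shift J ` K"]) simp
  qed
qed

section \<open>From relations to edge sets\<close>

definition edges_of :: "('a \<Rightarrow> 'a \<Rightarrow> bool) \<Rightarrow> 'a set \<Rightarrow> 'a set set" where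
  "edges_of A V = {{u, v} | u v. u \<in> V \<and> v \<in> V \<and> u \<noteq> v \<and> A u v}"

lemma edge_iff:
  assumes "symp A" "u \<in> V" "v \<in> V"
  shows "{u, v} \<in> edges_of A V \<longleftrightarrow> u \<noteq> v \<and> A u v"
  using assms by (auto simp: edges_of_def doubleton_eq_iff dest: sympD)

lemma edge_induced_iff:
  assumes "symp A" "S \<subseteq> V" "u \<in> S" "v \<in> S"
  shows "{u, v} \<in> induced_edges (edges_of A V) S \<longleftrightarrow> u \<noteq> v \<and> A u v"
proof -
  have "{u, v} \<in> edges_of A V \<longleftrightarrow> u \<noteq> v \<and> A u v" using assms by (intro edge_iff) auto
  then show ?thesis using assms(3,4) by (auto simp: induced_edges_def nsets_def)
qed

lemma simple_graph_edges_of: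
  "finite V \<Longrightarrow> V \<noteq> {} \<Longrightarrow> simple_graph V (edges_of A V)"
  by (auto simp: simple_graph_def edges_of_def nsets_def)

text \<open>The clique \<open>K\<close> from \<open>perf\<close> meets both bounds: \<open>c\<close>
  is injective on every clique, so none exceeds \<open>card K\<close>, and any proper colouring is
  injective on \<open>K\<close>.\<close>

lemma perfect_edges_of:
  assumes sym: "symp A" and fin: "finite V" and perf: "perf A V"
  shows "perfect V (edges_of A V)"
  unfolding perfect_def
proof (intro allI impI)
  fix S assume "S \<subseteq> V \<and> S \<noteq> {}"
  then have S: "S \<subseteq> V" by blast
  define F where "F = induced_edges (edges_of A V) S"
  have F: "{u, v} \<in> F \<longleftrightarrow> u \<noteq> v \<and> A u v" if "u \<in> S" "v \<in> S" for u v
    unfolding F_def by (rule edge_induced_iff[OF sym S that])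
  have finS: "finite S" using S fin finite_subset by blast
  obtain K c where K: "K \<subseteq> S" "pairwise A K" and c: "c ` S \<subseteq> K"
      and cp: "\<And>u v. u \<in> S \<Longrightarrow> v \<in> S \<Longrightarrow> A u v \<Longrightarrow> c u \<noteq> c v"
    using perfE[OF perf S] by metis
  have finK: "finite K" using K finS finite_subset by blast
  have KF: "K \<in> cliques S F"
    using K F by (auto simp: cliques_def clique_def pairwise_def subset_iff)
  have "card L \<le> card K" if "L \<in> cliques S F" for L
  proof -
    have L: "L \<subseteq> S" "\<And>u v. u \<in> L \<Longrightarrow> v \<in> L \<Longrightarrow> u \<noteq> v \<Longrightarrow> {u, v} \<in> F"
      using that by (auto simp: cliques_def clique_def)
    have "inj_on c L"
    proof (rule inj_onI, rule ccontr)
      fix u v assume uv: "u \<in> L" "v \<in> L" "c u = c v" "u \<noteq> v"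
      then have "u \<in> S" "v \<in> S" using L(1) by auto
      then show False using L(2)[of u v] F[of u v] cp[of u v] uv by simp
    qed
    moreover have "c ` L \<subseteq> K" using c L by blast
    ultimately show ?thesis using finK card_inj_on_le by blast
  qed
  moreover have "finite (cliques S F)" using finS by (simp add: cliques_def)
  ultimately have "clique_number S F = card K"
    unfolding clique_number_def using KF by (intro Max_eqI) auto
  moreover have "chromatic_number S F = card K"
    unfolding chromatic_number_def
  proof (rule Least_equality)
    \<comment> \<open>Numbering the vertices of \<open>K\<close> turns the vertex-valued colouring
      \<open>c\<close> into one by \<open>{1..card K}\<close>.\<close>
    obtain e :: "'a \<Rightarrow> nat" where e: "e ` K \<subseteq> {1..card K}" "inj_on e K"
      using ex_injective_coloring[OF finK] .
    have "(e \<circ> c) u \<noteq> (e \<circ> c) v" if "u \<in> S" "v \<in> S" "{u, v} \<in> F" for u v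
    proof -
      have "c u \<noteq> c v" using that F cp by blast
      moreover have "c u \<in> K" "c v \<in> K" using that c by auto
      ultimately show ?thesis using e(2) by (auto dest: inj_onD)
    qed
    moreover have "(e \<circ> c) ` S \<subseteq> {1..card K}" using e(1) c by fastforce
    ultimately show "k_colorable S F (card K)"
      unfolding k_colorable_def proper_coloring_def
      by (intro exI[of _ "e \<circ> c"] conjI ballI impI)
  next
    fix k assume "k_colorable S F k"
    then obtain \<psi> :: "'a \<Rightarrow> nat" where \<psi>: "\<psi> ` S \<subseteq> {1..k}" "proper_coloring S F \<psi>"
      unfolding k_colorable_def by (elim exE conjE)
    have "inj_on \<psi> K"
    proof (rule inj_onI, rule ccontr)
      fix u v assume uv: "u \<in> K" "v \<in> K" "\<psi> u = \<psi> v" "u \<noteq> v"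
      then have "u \<in> S" "v \<in> S" using K(1) by auto
      then show False
        using \<psi>(2) F[of u v] pairwiseD[OF K(2), of u v] uv by (simp add: proper_coloring_def)
    qed
    moreover have "\<psi> ` K \<subseteq> {1..k}" using \<psi>(1) K by blast
    ultimately have "card K \<le> card {1..k}" using card_inj_on_le by blast
    then show "card K \<le> k" by simp
  qed
  ultimately show "chromatic_number S (induced_edges (edges_of A V) S) =
      clique_number S (induced_edges (edges_of A V) S)"
    by (simp add: F_def)
qed

text \<open>Testing single vertices suffices: a strictly larger clique has a further vertex adjacent
  to all of \<open>K\<close>.\<close>

lemma maximal_clique_edges_of:
  assumes sym: "symp A" and K: "max_clique_rel A V K"
  shows "maximal_clique V (edges_of A V) K"
proof -
  have KV: "K \<subseteq> V" "pairwise A K" and max: "\<And>w. w \<in> V \<Longrightarrow> w \<notin> K \<Longrightarrow> \<exists>u\<in>K. \<not> A u w"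
    using K unfolding max_clique_rel_def by blast+
  have "K \<in> cliques V (edges_of A V)"
    using KV edge_iff[OF sym] by (auto simp: cliques_def clique_def pairwise_def subset_iff)
  moreover have "L = K" if L: "L \<in> cliques V (edges_of A V)" "K \<subseteq> L" for L
  proof (rule ccontr)
    assume "L \<noteq> K"
    then obtain w where w: "w \<in> L" "w \<notin> K" using L(2) by blast
    then obtain u where u: "u \<in> K" "\<not> A u w" using max L(1) by (auto simp: cliques_def)
    have "u \<in> L" "u \<noteq> w" using u w L by auto
    then have "{u, w} \<in> edges_of A V" using L(1) w by (simp add: cliques_def clique_def)
    moreover have "u \<in> V" "w \<in> V" using u(1) w(1) L by (auto simp: cliques_def)
    ultimately show False using u edge_iff[OF sym] by blast
  qed
  ultimately show ?thesis by (auto simp: maximal_clique_def)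
qed

section \<open>Transport to natural numbers and conclusion\<close>

lemma max_clique_rel_vimage:
  assumes g: "bij_betw g U V" and K: "max_clique_rel A V K"
  shows "max_clique_rel (\<lambda>u v. A (g u) (g v)) U (U \<inter> g -` K)"
    and "bij_betw g (U \<inter> g -` K) K"
proof -
  have inj: "inj_on g U" and im: "g ` U = V" using g by (auto simp: bij_betw_def)
  have KV: "K \<subseteq> V" using K by (simp add: max_clique_rel_def)
  have img: "g ` (U \<inter> g -` K) = K" using KV im by auto
  show "bij_betw g (U \<inter> g -` K) K"
    using inj img by (auto simp: bij_betw_def inj_on_def)
  have "\<exists>u\<in>U \<inter> g -` K. \<not> A (g u) (g w)" if "w \<in> U - (U \<inter> g -` K)" for w
  proof -
    have "g w \<in> V - K" using that im by blast
    then obtain u where "u \<in> K" "\<not> A u (g w)" using K unfolding max_clique_rel_def by blast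
    then show ?thesis using img by (metis (no_types, lifting) imageE)
  qed
  moreover have "pairwise (\<lambda>u v. A (g u) (g v)) (U \<inter> g -` K)"
    using K inj unfolding max_clique_rel_def pairwise_def inj_on_def by blast
  ultimately show "max_clique_rel (\<lambda>u v. A (g u) (g v)) U (U \<inter> g -` K)"
    unfolding max_clique_rel_def by blast
qed

theorem theorem1p1:
  fixes m :: nat
  assumes "m \<ge> 1"
  shows "\<exists>(V :: nat set) E. simple_graph V E \<and> perfect V E \<and> clique_chromatic_number V E \<ge> m"
proof -
  \<comment> \<open>Level \<open>m\<close> defeats every palette of at most \<open>m\<close>
    colours, in particular each \<open>k < m\<close>.\<close>
  define I where "I = {..<root_size m}"
  define W where "W = verts m I"
  have I: "finite I" "card I = root_size m" by (auto simp: I_def)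
  have finW: "finite W" using finite_verts I by (simp add: W_def)
  have "0 \<in> I" using root_size_ge_2[of m] by (auto simp: I_def)
  then have neW: "W \<noteq> {}" using root_in_verts unfolding W_def by blast
  \<comment> \<open>Adjacency is pulled back along an enumeration of \<open>W\<close>, since the
    vertices sought are natural numbers.\<close>
  obtain g where g: "bij_betw g {0..<card W} W" using ex_bij_betw_nat_finite[OF finW] by blast
  define V where "V = {0..<card W}"
  define B where "B u v = adj (g u) (g v)" for u v
  define E where "E = edges_of B V"
  have gV: "bij_betw g V W" using g by (simp add: V_def)
  have symB: "symp B" by (rule sympI) (simp add: B_def adj_commute)
  have finV: "finite V" and "V \<noteq> {}" using finW neW by (auto simp: V_def)
  then have simple: "simple_graph V E" unfolding E_def by (rule simple_graph_edges_of)
  have "perf B V"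
    by (rule perf_vimage[OF perf_verts[OF I(1), of m], of g])
      (use gV in \<open>auto simp: bij_betw_def W_def B_def\<close>)
  then have perfect: "perfect V E" unfolding E_def by (rule perfect_edges_of[OF symB finV])
  have "\<not> k_clique_colorable V E k" if km: "k < m" for k
  proof
    assume "k_clique_colorable V E k"
    then obtain \<phi> :: "nat \<Rightarrow> nat" where \<phi>: "\<phi> ` V \<subseteq> {1..k}" "clique_coloring V E \<phi>"
      unfolding k_clique_colorable_def by blast
    define \<psi> where "\<psi> = \<phi> \<circ> inv_into V g"
    have "\<psi> ` W \<subseteq> {1..k}"
      using \<phi>(1) gV by (auto simp: \<psi>_def bij_betw_def)
    then obtain K where K: "max_clique_rel adj W K" "2 \<le> card K" "monochromatic_set \<psi> K"
      using monochromatic_max_clique[OF I(2), of "{1..k}" \<psi>] km by (auto simp: W_def)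
    let ?K = "V \<inter> g -` K"
    have "max_clique_rel B V ?K" and bij: "bij_betw g ?K K"
      using max_clique_rel_vimage[OF gV K(1)] unfolding B_def by blast+
    then have "maximal_clique V E ?K"
      unfolding E_def using maximal_clique_edges_of[OF symB] by blast
    moreover have "2 \<le> card ?K" using bij_betw_same_card[OF bij] K(2) by simp
    moreover have "monochromatic_set \<phi> ?K"
    proof -
      have "\<phi> u = \<psi> (g u)" if "u \<in> V" for u
        using that gV by (simp add: \<psi>_def bij_betw_def)
      then show ?thesis
        using K(3) unfolding monochromatic_set_def by (metis IntD1 IntD2 vimageD)
    qed
    ultimately show False using \<phi>(2) unfolding clique_coloring_def by blast
  qed
  \<comment> \<open>The least number is attained because \<open>card V\<close> colours suffice;
    hence it cannot lie below \<open>m\<close>.\<close>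
  moreover have "k_clique_colorable V E (clique_chromatic_number V E)"
    unfolding clique_chromatic_number_def
    by (rule LeastI[of _ "card V"]) (rule k_clique_colorable_card[OF simple])
  ultimately have "clique_chromatic_number V E \<ge> m" by (meson not_le)
  with simple perfect show ?thesis by blast
qed

end
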